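(* Suppose that $\pi_\Psi$ is positive and continuous and that we have a regular discretization $\{B_\lambda(\psi):\psi\in\Psi\}$, $\lambda>0$, of $\Psi$. Further suppose that, for every $x$, $\psi_{\mathrm{LRSE}}(x)$ is the unique maximizer of $\psi\mapsto\pi_\Psi(\psi\,|\,x)/\pi_\Psi(\psi)$ and, for any $\epsilon>0$, $$\sup_{\{\psi:\|\psi-\psi_{\mathrm{LRSE}}(x)\|\geq\epsilon\}}\frac{\pi_\Psi(\psi\,|\,x)}{\pi_\Psi(\psi)}<\frac{\pi_\Psi(\psi_{\mathrm{LRSE}}(x)\,|\,x)}{\pi_\Psi(\psi_{\mathrm{LRSE}}(x))}.$$ Let $\hat\psi_\lambda(x)$ be the least relative surprise estimator of the discretized problem, i.e. $\hat\psi_\lambda(x)$ maximizes $\Pi_\Psi(B_\lambda(\psi)\,|\,x)/\Pi_\Psi(B_\lambda(\psi))$ as a function of $\psi\in\Psi_\lambda$. Then $\hat\psi_\lambda$ converges to $\psi_{\mathrm{LRSE}}$ as $\lambda\to0$, that is, $\hat\psi_\lambda(x)\to\psi_{\mathrm{LRSE}}(x)$ for every $x$.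
   Context: Setting: $\{f_\theta:\theta\in\Theta\}$ is a family of probability densities with respect to a support measure $\mu$ on a sample space $\mathcal X$. $\Pi$ is a proper prior (probability measure) on $\Theta$ with density $\pi$ with respect to a support measure $\nu$. Put $m(x)=\int_\Theta \pi(\theta)f_\theta(x)\,\nu(d\theta)$. The posterior $\Pi(\cdot\,|\,x)$ has density $\pi(\theta)f_\theta(x)/m(x)$ with respect to $\nu$. A map $\Psi:\Theta\to\Psi$ is given; the same symbol $\Psi$ denotes the map and its target space. $\Pi_\Psi$ and $\Pi_\Psi(\cdot\,|\,x)$ are the marginal prior and marginal posterior of $\psi=\Psi(\theta)$, with densities $\pi_\Psi$ and $\pi_\Psi(\cdot\,|\,x)$ with respect to a support measure $\nu_\Psi$ on $\Psi$. All spaces are open subsets of Euclidean spaces, the support measures are Euclidean volume on these sets, and mappings are assumed to be sufficiently smooth. $\psi_{\mathrm{LRSE}}(x)$ (least relative surprise estimator) denotes the maximizer over $\psi\in\Psi$ of $\pi_\Psi(\psi\,|\,x)/\pi_\Psi(\psi)$. Regular discretization: for each $\lambda>0$, $\{B_\lambda(\psi):\psi\in\Psi\}$ is a countable partition of $\Psi$ with $\psi\in B_\lambda(\psi)$ and $\Pi_\Psi(B_\lambda(\psi))>0$ (so $B_\lambda(\psi)$ is the cell containing $\psi$); $\sup_{\psi\in\Psi}\mathrm{diam}(B_\lambda(\psi))\to0$ as $\lambda\to0$; and $\Pi_\Psi(B_\lambda(\psi))/\nu_\Psi(B_\lambda(\psi))\to\pi_\Psi(\psi)$ as $\lambda\to0$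 for every $\psi$. One point $\psi_\lambda(\psi)\in B_\lambda(\psi)$ is chosen in each cell, so that $\psi_\lambda(\psi')=\psi_\lambda(\psi)$ whenever $\psi'\in B_\lambda(\psi)$, and $\Psi_\lambda=\{\psi_\lambda(\psi):\psi\in\Psi\}$. The discretized problem has parameter space $\Psi_\lambda$ with prior probabilities $\Pi_\Psi(B_\lambda(\psi))$ and posterior probabilities $\Pi_\Psi(B_\lambda(\psi)\,|\,x)$, $\psi\in\Psi_\lambda$. *)

theory Defs
  imports "HOL-Probability.Probability"
begin

definition volume_on :: "'a::euclidean_space set \<Rightarrow> 'a measure" where
  "volume_on S = restrict_space lborel S"

definition prior_measure :: "'t::euclidean_space set \<Rightarrow> ('t \<Rightarrow> real) \<Rightarrow> 't measure" where
  "prior_measure \<Theta> p = density (volume_on \<Theta>) (\<lambda>\<theta>. ennreal (p \<theta>))"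

definition bayesian_model ::
  "'x::euclidean_space set \<Rightarrow> 't::euclidean_space set \<Rightarrow> ('t \<Rightarrow> real) \<Rightarrow> ('t \<Rightarrow> 'x \<Rightarrow> real) \<Rightarrow> bool"
where
  "bayesian_model X \<Theta> p f \<longleftrightarrow>
     open X \<and> open \<Theta> \<and>
     p \<in> borel_measurable (volume_on \<Theta>) \<and> (\<forall>\<theta>\<in>\<Theta>. 0 \<le> p \<theta>) \<and>
     prob_space (prior_measure \<Theta> p) \<and>
     (\<lambda>(\<theta>, x). f \<theta> x) \<in> borel_measurable (volume_on \<Theta> \<Otimes>\<^sub>M volume_on X) \<and>
     (\<forall>\<theta>\<in>\<Theta>. \<forall>x\<in>X. 0 \<le> f \<theta> x) \<and>
     (\<forall>\<theta>\<in>\<Theta>. prob_space (density (volume_on X) (\<lambda>x. ennreal (f \<theta> x))))"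

definition prior_predictive ::
  "'t::euclidean_space set \<Rightarrow> ('t \<Rightarrow> real) \<Rightarrow> ('t \<Rightarrow> 'x \<Rightarrow> real) \<Rightarrow> 'x \<Rightarrow> ennreal"
where
  "prior_predictive \<Theta> p f x = (\<integral>\<^sup>+ \<theta>. ennreal (p \<theta> * f \<theta> x) \<partial>volume_on \<Theta>)"

definition posterior_measure ::
  "'t::euclidean_space set \<Rightarrow> ('t \<Rightarrow> real) \<Rightarrow> ('t \<Rightarrow> 'x \<Rightarrow> real) \<Rightarrow> 'x \<Rightarrow> 't measure"
where
  "posterior_measure \<Theta> p f x =
     density (volume_on \<Theta>) (\<lambda>\<theta>. ennreal (p \<theta> * f \<theta> x) / prior_predictive \<Theta> p f x)"

(* The data values at which the posterior is a probability measure. At any other x the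
   quotient p(theta) f_theta(x) / m(x) is not a density and there is no posterior. *)
definition posterior_domain ::
  "'x set \<Rightarrow> 't::euclidean_space set \<Rightarrow> ('t \<Rightarrow> real) \<Rightarrow> ('t \<Rightarrow> 'x \<Rightarrow> real) \<Rightarrow> 'x set"
where
  "posterior_domain X \<Theta> p f = {x \<in> X. 0 < prior_predictive \<Theta> p f x \<and> prior_predictive \<Theta> p f x < \<infinity>}"

definition marginal_measure ::
  "'t measure \<Rightarrow> ('t \<Rightarrow> 's::euclidean_space) \<Rightarrow> 's set \<Rightarrow> 's measure"
where
  "marginal_measure M T \<Psi> = distr M (volume_on \<Psi>) T"

(* distributed truncates a negative density to 0, so nonnegativity is stated separately. *)
definition marginal_density ::
  "'t measure \<Rightarrow> ('t \<Rightarrow> 's::euclidean_space) \<Rightarrow> 's set \<Rightarrow> ('s \<Rightarrow> real) \<Rightarrow> bool"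
where
  "marginal_density M T \<Psi> g \<longleftrightarrow>
     (\<forall>\<psi>\<in>\<Psi>. 0 \<le> g \<psi>) \<and> distributed M (volume_on \<Psi>) T (\<lambda>\<psi>. ennreal (g \<psi>))"

(* Extended-valued, because the library's real-valued diameter is
   unspecified on unbounded sets. *)
definition ediameter :: "'a::metric_space set \<Rightarrow> ennreal" where
  "ediameter S = (SUP a\<in>S. SUP b\<in>S. ennreal (dist a b))"

(* B l \<psi> is the cell of the partition at mesh parameter l that contains \<psi>, P is the marginal
   prior and g its density. A cell may have infinite volume (and then measure 0 in the quotient)
   only for l bounded away from 0, since the diameters tend to 0. *)
definition regular_discretization ::
  "'s::euclidean_space set \<Rightarrow> 's measure \<Rightarrow> ('s \<Rightarrow> real) \<Rightarrow> (real \<Rightarrow> 's \<Rightarrow> 's set) \<Rightarrow> bool"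
where
  "regular_discretization \<Psi> P g B \<longleftrightarrow>
     (\<forall>l>0. countable (B l ` \<Psi>) \<and> partition_on \<Psi> (B l ` \<Psi>) \<and>
        (\<forall>\<psi>\<in>\<Psi>. \<psi> \<in> B l \<psi> \<and> B l \<psi> \<in> sets (volume_on \<Psi>) \<and> 0 < measure P (B l \<psi>))) \<and>
     ((\<lambda>l. SUP \<psi>\<in>\<Psi>. ediameter (B l \<psi>)) \<longlongrightarrow> 0) (at_right 0) \<and>
     (\<forall>\<psi>\<in>\<Psi>. ((\<lambda>l. measure P (B l \<psi>) / measure (volume_on \<Psi>) (B l \<psi>)) \<longlongrightarrow> g \<psi>) (at_right 0))"

definition cell_representatives ::
  "'s set \<Rightarrow> (real \<Rightarrow> 's \<Rightarrow> 's set) \<Rightarrow> (real \<Rightarrow> 's \<Rightarrow> 's) \<Rightarrow> bool"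
where
  "cell_representatives \<Psi> B r \<longleftrightarrow>
     (\<forall>l>0. \<forall>\<psi>\<in>\<Psi>. r l \<psi> \<in> B l \<psi> \<and> (\<forall>\<psi>'\<in>B l \<psi>. r l \<psi>' = r l \<psi>))"

(* post and prior are densities in the continuous problem and probabilities
   in a discrete one. *)
definition is_lrse :: "('s \<Rightarrow> real) \<Rightarrow> ('s \<Rightarrow> real) \<Rightarrow> 's set \<Rightarrow> 's \<Rightarrow> bool" where
  "is_lrse post prior S \<psi> \<longleftrightarrow> is_arg_max (\<lambda>\<psi>. post \<psi> / prior \<psi>) (\<lambda>\<psi>. \<psi> \<in> S) \<psi>"

end

theory Submission
  imports Defs
begin

text \<open>
  Let \<open>g\<close> and \<open>h\<close> be the marginal prior and posterior densities at a fixed data value. The prior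
  \<open>P A\<close> and the posterior \<open>Q A\<close> of a cell \<open>A\<close> are the integrals of \<open>g\<close> and \<open>h\<close> over \<open>A\<close>, so the ratio
  \<open>Q A / P A\<close> is an average of the relative belief ratio \<open>h / g\<close> with respect to the prior
  restricted to \<open>A\<close>, and lies between the infimum and the supremum of \<open>h / g\<close> on the cell.

  Let \<open>y\<close> maximize \<open>h / g\<close> and let \<open>e > 0\<close>. The separation hypothesis leaves room for two constants
  \<open>c < c'\<close> strictly between the supremum of \<open>h / g\<close> at distance at least \<open>e / 2\<close> from \<open>y\<close> and its value
  at \<open>y\<close>. Once the mesh is fine enough, the cell of \<open>y\<close> lies in a neighbourhood on which continuity
  keeps \<open>h / g\<close> above \<open>c'\<close>, so its ratio is at least \<open>c'\<close>. Any cell with a point at distance at least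
  \<open>e\<close> from \<open>y\<close> stays at distance at least \<open>e / 2\<close>, so its ratio is at most \<open>c\<close>. The maximizing cell
  therefore cannot have its representative at distance \<open>e\<close> or more from \<open>y\<close>.

  The two averaging bounds are instances of \<open>measure_density_scaled_mono\<close>; the uniform control of the
  mesh is \<open>eventually_cells_small\<close>; and \<open>discretized_lrse_tendsto\<close> carries the comparison of cells.
\<close>

text \<open>
  Constants on both sides let the same bound serve for upper and for lower estimates of the ratio of
  the two measures of \<open>A\<close>. Finiteness on the larger side is essential, because the real-valued
  measure of a set of infinite measure is 0.
\<close>

lemma measure_density_scaled_mono:
  fixes g h :: "'a \<Rightarrow> real"
  assumes A: "A \<in> sets N"
    and g: "(\<lambda>y. ennreal (g y)) \<in> borel_measurable N"
    and h: "(\<lambda>y. ennreal (h y)) \<in> borel_measurable N"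
    and a: "0 \<le> a" and b: "0 \<le> b"
    and le: "\<And>y. y \<in> A \<Longrightarrow> a * g y \<le> b * h y"
    and fin: "emeasure (density N (\<lambda>y. ennreal (h y))) A < \<infinity>"
  shows "ennreal a * emeasure (density N (\<lambda>y. ennreal (g y))) A
           \<le> ennreal b * emeasure (density N (\<lambda>y. ennreal (h y))) A"
    and "a * measure (density N (\<lambda>y. ennreal (g y))) A
           \<le> b * measure (density N (\<lambda>y. ennreal (h y))) A"
proof -
  have pointwise: "ennreal a * (ennreal (g y) * indicator A y)
      \<le> ennreal b * (ennreal (h y) * indicator A y)" for y
    using le[of y] a b by (auto simp: indicator_def ennreal_mult'[symmetric] ennreal_leI)
  have "ennreal a * emeasure (density N (\<lambda>y. ennreal (g y))) A
      = (\<integral>\<^sup>+y. ennreal a * (ennreal (g y) * indicator A y) \<partial>N)"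
    using A g by (simp add: emeasure_density nn_integral_cmult)
  also have "\<dots> \<le> (\<integral>\<^sup>+y. ennreal b * (ennreal (h y) * indicator A y) \<partial>N)"
    by (intro nn_integral_mono pointwise)
  also have "\<dots> = ennreal b * emeasure (density N (\<lambda>y. ennreal (h y))) A"
    using A h by (simp add: emeasure_density nn_integral_cmult)
  finally show main: "ennreal a * emeasure (density N (\<lambda>y. ennreal (g y))) A
      \<le> ennreal b * emeasure (density N (\<lambda>y. ennreal (h y))) A" .
  have "enn2real (ennreal a * emeasure (density N (\<lambda>y. ennreal (g y))) A)
      \<le> enn2real (ennreal b * emeasure (density N (\<lambda>y. ennreal (h y))) A)"
    using fin by (intro enn2real_mono main) (simp add: ennreal_mult_less_top)
  then show "a * measure (density N (\<lambda>y. ennreal (g y))) A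
      \<le> b * measure (density N (\<lambda>y. ennreal (h y))) A"
    using a b by (simp add: enn2real_mult measure_def)
qed

lemma regular_discretization_cells:
  assumes "regular_discretization \<Psi> P g B" "0 < l" "\<psi> \<in> \<Psi>"
  shows "\<psi> \<in> B l \<psi>" "B l \<psi> \<subseteq> \<Psi>" "B l \<psi> \<in> sets (volume_on \<Psi>)" "0 < measure P (B l \<psi>)"
proof -
  have "\<Union> (B l ` \<Psi>) = \<Psi>"
    using assms by (simp add: regular_discretization_def partition_on_def)
  then show "B l \<psi> \<subseteq> \<Psi>" using \<open>\<psi> \<in> \<Psi>\<close> by blast
qed (use assms in \<open>auto simp: regular_discretization_def\<close>)

lemma regular_discretization_cell_eq:
  assumes reg: "regular_discretization \<Psi> P g B" and l: "0 < l"
    and \<psi>: "\<psi> \<in> \<Psi>" and y: "y \<in> B l \<psi>"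
  shows "B l y = B l \<psi>"
proof -
  have y': "y \<in> \<Psi>" using regular_discretization_cells(2)[OF reg l \<psi>] y by blast
  have part: "partition_on \<Psi> (B l ` \<Psi>)"
    using reg l by (auto simp: regular_discretization_def)
  have "B l y \<inter> B l \<psi> \<noteq> {}"
    using regular_discretization_cells(1)[OF reg l y'] y by blast
  then show ?thesis
    using partition_onD2[OF part] y' \<psi> by (auto simp: disjoint_def)
qed

lemma eventually_cells_small:
  assumes reg: "regular_discretization \<Psi> P g B" and d: "0 < d"
  shows "\<forall>\<^sub>F l in at_right 0. \<forall>\<psi>\<in>\<Psi>. \<forall>a\<in>B l \<psi>. \<forall>b\<in>B l \<psi>. dist a b < d"
proof -
  have "((\<lambda>l. SUP \<psi>\<in>\<Psi>. ediameter (B l \<psi>)) \<longlongrightarrow> 0) (at_right 0)"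
    using reg by (simp add: regular_discretization_def)
  then have "\<forall>\<^sub>F l in at_right 0. (SUP \<psi>\<in>\<Psi>. ediameter (B l \<psi>)) < ennreal d"
    by (rule order_tendstoD) (simp add: d)
  then show ?thesis
  proof eventually_elim
    case (elim l)
    show ?case
    proof (intro ballI)
      fix \<psi> a b assume "\<psi> \<in> \<Psi>" "a \<in> B l \<psi>" "b \<in> B l \<psi>"
      then have "ennreal (dist a b) \<le> (SUP \<psi>\<in>\<Psi>. ediameter (B l \<psi>))"
        unfolding ediameter_def by (meson SUP_upper2 order_refl)
      then show "dist a b < d"
        using elim d by (metis ennreal_less_iff order_le_less_trans zero_le_dist)
    qed
  qed
qed

text \<open>
  The comparison of cells for a single data value, with \<open>g\<close> and \<open>h\<close> the marginal prior and posterior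
  densities. The maximality of \<open>y\<close> bounds \<open>h / g\<close> globally by its value at \<open>y\<close>, so the posterior
  inherits from the prior that cells have finite measure; without this the lower estimate at the cell
  of \<open>y\<close> would not pass to real-valued measures.
\<close>

lemma discretized_lrse_tendsto:
  fixes \<Psi> :: "'s::euclidean_space set" and g h :: "'s \<Rightarrow> real"
  defines "P \<equiv> density (volume_on \<Psi>) (\<lambda>\<psi>. ennreal (g \<psi>))"
    and "Q \<equiv> density (volume_on \<Psi>) (\<lambda>\<psi>. ennreal (h \<psi>))"
  assumes g_meas: "(\<lambda>\<psi>. ennreal (g \<psi>)) \<in> borel_measurable (volume_on \<Psi>)"
    and h_meas: "(\<lambda>\<psi>. ennreal (h \<psi>)) \<in> borel_measurable (volume_on \<Psi>)"
    and g_pos: "\<And>\<psi>. \<psi> \<in> \<Psi> \<Longrightarrow> 0 < g \<psi>"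
    and h_nonneg: "\<And>\<psi>. \<psi> \<in> \<Psi> \<Longrightarrow> 0 \<le> h \<psi>"
    and cont: "continuous_on \<Psi> (\<lambda>\<psi>. h \<psi> / g \<psi>)"
    and reg: "regular_discretization \<Psi> P g' B"
    and reps: "cell_representatives \<Psi> B r"
    and y: "is_lrse h g \<Psi> y"
    and separated: "\<And>\<epsilon>. 0 < \<epsilon> \<Longrightarrow>
      (SUP \<psi>\<in>{\<psi>\<in>\<Psi>. norm (\<psi> - y) \<ge> \<epsilon>}. ereal (h \<psi> / g \<psi>)) < ereal (h y / g y)"
    and z: "\<And>l. 0 < l \<Longrightarrow>
      is_lrse (\<lambda>\<psi>. measure Q (B l \<psi>)) (\<lambda>\<psi>. measure P (B l \<psi>)) (r l ` \<Psi>) (z l)"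
  shows "(z \<longlongrightarrow> y) (at_right 0)"
proof (rule tendstoI)
  fix e :: real assume e: "0 < e"
  have yin: "y \<in> \<Psi>" and ymax: "\<And>\<psi>. \<psi> \<in> \<Psi> \<Longrightarrow> h \<psi> / g \<psi> \<le> h y / g y"
    using y by (auto simp: is_lrse_def is_arg_max_linorder)
  have "0 < e / 2" using e by simp
  from ereal_dense2[OF separated[OF this]] obtain c where
    c_far: "(SUP \<psi>\<in>{\<psi>\<in>\<Psi>. norm (\<psi> - y) \<ge> e / 2}. ereal (h \<psi> / g \<psi>)) < ereal c"
    and c_top: "ereal c < ereal (h y / g y)"
    by blast
  then obtain c' where c': "c < c'" "c' < h y / g y"
    using dense[of c "h y / g y"] by auto
  have far: "h \<psi> / g \<psi> < c" if "\<psi> \<in> \<Psi>" "e / 2 \<le> dist \<psi> y" for \<psi>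
    using SUP_lessD[OF c_far, of \<psi>] that by (simp add: dist_norm)
  have "((\<lambda>\<psi>. h \<psi> / g \<psi>) \<longlongrightarrow> h y / g y) (at y within \<Psi>)"
    using cont yin by (simp add: continuous_on_def)
  then have "\<forall>\<^sub>F \<psi> in at y within \<Psi>. c' < h \<psi> / g \<psi>"
    using c'(2) by (rule order_tendstoD)
  then obtain d where d: "0 < d"
    and "\<And>\<psi>. \<psi> \<in> \<Psi> \<Longrightarrow> \<psi> \<noteq> y \<Longrightarrow> dist \<psi> y < d \<Longrightarrow> c' < h \<psi> / g \<psi>"
    unfolding eventually_at by blast
  then have near: "c' < h \<psi> / g \<psi>" if "\<psi> \<in> \<Psi>" "dist \<psi> y < d" for \<psi>
    using that c'(2) by (cases "\<psi> = y") auto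
  have "0 < min d (e / 2)" using d e by simp
  note small = eventually_cells_small[OF reg this]
  show "\<forall>\<^sub>F l in at_right 0. dist (z l) y < e"
    using small eventually_at_right_less
  proof eventually_elim
    case (elim l)
    note l = \<open>0 < l\<close>
    note cells = regular_discretization_cells[OF reg l]
    have rep: "r l \<psi> \<in> B l \<psi>" if "\<psi> \<in> \<Psi>" for \<psi>
      using reps l that by (auto simp: cell_representatives_def)
    have zl: "z l \<in> \<Psi>"
      using z[OF l] rep cells(2) by (fastforce simp: is_lrse_def is_arg_max_linorder)
    have "measure Q (B l (r l y)) / measure P (B l (r l y))
        \<le> measure Q (B l (z l)) / measure P (B l (z l))"
      using z[OF l] yin by (auto simp: is_lrse_def is_arg_max_linorder)
    then have best: "measure Q (B l y) / measure P (B l y)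
        \<le> measure Q (B l (z l)) / measure P (B l (z l))"
      using regular_discretization_cell_eq[OF reg l yin rep[OF yin]] by simp
    have P_fin: "emeasure P (B l \<psi>) < \<infinity>" if "\<psi> \<in> \<Psi>" for \<psi>
      \<comment> \<open>a cell of infinite measure would have real-valued measure 0\<close>
      using cells(4)[OF that] by (simp add: measure_def enn2real_positive_iff)
    show ?case
    proof (rule ccontr)
      assume "\<not> dist (z l) y < e"
      then have zfar: "e \<le> dist (z l) y" by simp
      have c_nonneg: "0 \<le> c"
        \<comment> \<open>\<open>z l\<close> lies in the far region, where the nonnegative ratio \<open>h / g\<close> is below \<open>c\<close>\<close>
        using far[OF zl] zfar e h_nonneg[OF zl] g_pos[OF zl]
        by (smt (verit) divide_nonneg_pos field_sum_of_halves)
      have "h \<psi> \<le> c * g \<psi>" if "\<psi> \<in> B l (z l)" for \<psi>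
      proof -
        have \<psi>: "\<psi> \<in> \<Psi>" using cells(2)[OF zl] that by blast
        have "dist (z l) \<psi> < e / 2"
          using elim(1) zl that cells(1)[OF zl] by fastforce
        then have "e / 2 \<le> dist \<psi> y"
          using zfar dist_triangle[of "z l" y \<psi>] by simp
        then show ?thesis
          using far[OF \<psi>] g_pos[OF \<psi>] by (simp add: pos_divide_less_eq)
      qed
      then have "measure Q (B l (z l)) \<le> c * measure P (B l (z l))"
        using measure_density_scaled_mono(2)[OF cells(3)[OF zl] h_meas g_meas, of 1 c]
          c_nonneg P_fin[OF zl] by (simp add: P_def Q_def)
      then have upper: "measure Q (B l (z l)) / measure P (B l (z l)) \<le> c"
        using cells(4)[OF zl] by (simp add: pos_divide_le_eq)
      have "c' * g \<psi> \<le> h \<psi>" if "\<psi> \<in> B l y" for \<psi>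
      proof -
        have \<psi>: "\<psi> \<in> \<Psi>" using cells(2)[OF yin] that by blast
        have "dist \<psi> y < d"
          using elim(1) yin that cells(1)[OF yin] by fastforce
        then show ?thesis
          using near[OF \<psi>] g_pos[OF \<psi>] by (simp add: pos_less_divide_eq)
      qed
      moreover have "emeasure Q (B l y) < \<infinity>"
      proof -
        have "h \<psi> \<le> (h y / g y) * g \<psi>" if "\<psi> \<in> B l y" for \<psi>
          using ymax[of \<psi>] g_pos[of \<psi>] cells(2)[OF yin] that
          by (metis pos_divide_le_eq subsetD)
        then have "emeasure Q (B l y) \<le> ennreal (h y / g y) * emeasure P (B l y)"
          using measure_density_scaled_mono(1)[OF cells(3)[OF yin] h_meas g_meas, of 1 "h y / g y"]
            h_nonneg[OF yin] g_pos[OF yin] P_fin[OF yin] by (simp add: P_def Q_def)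
        also have "\<dots> < \<infinity>"
          using P_fin[OF yin] by (simp add: ennreal_mult_less_top)
        finally show ?thesis .
      qed
      ultimately have "c' * measure P (B l y) \<le> measure Q (B l y)"
        using measure_density_scaled_mono(2)[OF cells(3)[OF yin] g_meas h_meas, of c' 1]
          c_nonneg c'(1) by (simp add: P_def Q_def)
      then have "c' \<le> measure Q (B l y) / measure P (B l y)"
        using cells(4)[OF yin] by (simp add: pos_le_divide_eq)
      then show False using upper best c'(1) by linarith
    qed
  qed
qed

lemma marginal_densityD:
  assumes "marginal_density M T \<Psi> g"
  shows "marginal_measure M T \<Psi> = density (volume_on \<Psi>) (\<lambda>\<psi>. ennreal (g \<psi>))"
    and "(\<lambda>\<psi>. ennreal (g \<psi>)) \<in> borel_measurable (volume_on \<Psi>)"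
    and "\<And>\<psi>. \<psi> \<in> \<Psi> \<Longrightarrow> 0 \<le> g \<psi>"
  using assms by (auto simp: marginal_density_def marginal_measure_def distributed_def)

theorem corollary7:
  fixes X :: "'x::euclidean_space set"
    and \<Theta> :: "'t::euclidean_space set"
    and \<Psi> :: "'s::euclidean_space set"
    and p :: "'t \<Rightarrow> real"
    and f :: "'t \<Rightarrow> 'x \<Rightarrow> real"
    and T :: "'t \<Rightarrow> 's"
    and prior_dens :: "'s \<Rightarrow> real"
    and post_dens :: "'x \<Rightarrow> 's \<Rightarrow> real"
    and B :: "real \<Rightarrow> 's \<Rightarrow> 's set"
    and r :: "real \<Rightarrow> 's \<Rightarrow> 's"
    and lrse :: "'x \<Rightarrow> 's"
    and lrse_disc :: "real \<Rightarrow> 'x \<Rightarrow> 's"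
  defines "D \<equiv> posterior_domain X \<Theta> p f"
    and "Prior \<equiv> marginal_measure (prior_measure \<Theta> p) T \<Psi>"
    and "Post \<equiv> \<lambda>x. marginal_measure (posterior_measure \<Theta> p f x) T \<Psi>"
  assumes model: "bayesian_model X \<Theta> p f"
    and open_Psi: "open \<Psi>"
    and prior_dens: "marginal_density (prior_measure \<Theta> p) T \<Psi> prior_dens"
    and post_dens: "\<forall>x\<in>D. marginal_density (posterior_measure \<Theta> p f x) T \<Psi> (post_dens x)"
    and post_dens_cont: "\<forall>x\<in>D. continuous_on \<Psi> (post_dens x)"
    and prior_dens_pos: "\<forall>\<psi>\<in>\<Psi>. 0 < prior_dens \<psi>"
    and prior_dens_cont: "continuous_on \<Psi> prior_dens"
    and regular: "regular_discretization \<Psi> Prior prior_dens B"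
    and representatives: "cell_representatives \<Psi> B r"
    and lrse: "\<forall>x\<in>D. is_lrse (post_dens x) prior_dens \<Psi> (lrse x)"
    and lrse_unique: "\<forall>x\<in>D. \<forall>\<psi>. is_lrse (post_dens x) prior_dens \<Psi> \<psi> \<longrightarrow> \<psi> = lrse x"
    and separated: "\<forall>x\<in>D. \<forall>\<epsilon>>0.
      (SUP \<psi>\<in>{\<psi>\<in>\<Psi>. norm (\<psi> - lrse x) \<ge> \<epsilon>}. ereal (post_dens x \<psi> / prior_dens \<psi>))
        < ereal (post_dens x (lrse x) / prior_dens (lrse x))"
    and lrse_disc: "\<forall>x\<in>D. \<forall>l>0.
      is_lrse (\<lambda>\<psi>. measure (Post x) (B l \<psi>)) (\<lambda>\<psi>. measure Prior (B l \<psi>)) (r l ` \<Psi>) (lrse_disc l x)"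
  shows "\<forall>x\<in>D. ((\<lambda>l. lrse_disc l x) \<longlongrightarrow> lrse x) (at_right 0)"
proof
  fix x assume x: "x \<in> D"
  note prior = marginal_densityD[OF prior_dens]
  note post = marginal_densityD[OF post_dens[rule_format, OF x]]
  have cont: "continuous_on \<Psi> (\<lambda>\<psi>. post_dens x \<psi> / prior_dens \<psi>)"
    using post_dens_cont x prior_dens_cont prior_dens_pos
    by (intro continuous_on_divide) (auto simp: less_le)
  show "((\<lambda>l. lrse_disc l x) \<longlongrightarrow> lrse x) (at_right 0)"
  proof (rule discretized_lrse_tendsto[OF prior(2) post(2) _ post(3) cont _ representatives])
    show "regular_discretization \<Psi> (density (volume_on \<Psi>) (\<lambda>\<psi>. ennreal (prior_dens \<psi>))) prior_dens B"
      using regular by (simp add: Prior_def prior(1))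
    show "is_lrse (\<lambda>\<psi>. measure (density (volume_on \<Psi>) (\<lambda>\<psi>. ennreal (post_dens x \<psi>))) (B l \<psi>))
        (\<lambda>\<psi>. measure (density (volume_on \<Psi>) (\<lambda>\<psi>. ennreal (prior_dens \<psi>))) (B l \<psi>))
        (r l ` \<Psi>) (lrse_disc l x)" if "0 < l" for l
      using lrse_disc[rule_format, OF x that] by (simp add: Prior_def Post_def prior(1) post(1))
  qed (use prior_dens_pos lrse separated x in simp_all)
qed

end
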